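(* Let $H$ be a real Hilbert space, $C\subseteq H$ a nonempty convex subset, $0\leq\kappa<1$, and let $T:C\to C$ be a $\kappa$-strict pseudo-contraction. Let $(\lambda_n)_{n\in\mathbb{N}}$ be a sequence in $(\kappa,1)$ such that $\sum_{n=0}^\infty(\lambda_n-\kappa)(1-\lambda_n)=\infty$ with rate of divergence $\theta:\mathbb{N}\to\mathbb{N}$. Let $x\in C$ and $b>0$ be such that $\|x-Tx\|\leq b$ and $T$ has approximate fixed points in a $b$-neighborhood of $x$. Let $(x_n)$ be the Mann iteration starting with $x$, that is, $x_0:=x$ and $x_{n+1}:=\lambda_n x_n+(1-\lambda_n)Tx_n$ for all $n\in\mathbb{N}$. Then $\lim_{n\to\infty}\|x_n-Tx_n\|=0$ and, moreover, for every $\varepsilon>0$ and every $n\geq\Phi(\varepsilon,b,\theta)$ one has $\|x_n-Tx_n\|<\varepsilon$, where $$\Phi(\varepsilon,b,\theta)=\theta\left(\left\lceil\frac{b^2}{\varepsilon^2}\right\rceil\right).$$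
   Context: $\mathbb{N}=\{0,1,2,\dots\}$. For $0\leq\kappa<1$, a mapping $T:C\to C$ is a $\kappa$-strict pseudo-contraction if for all $u,v\in C$, $\|Tu-Tv\|^2\leq\|u-v\|^2+\kappa\|u-Tu-(v-Tv)\|^2$. $T$ has approximate fixed points in a $b$-neighborhood of $x$ if for every $\delta>0$ there exists $y\in C$ with $\|x-y\|\leq b$ and $\|y-Ty\|<\delta$. A rate of divergence for a divergent series $\sum_{n=0}^\infty a_n$ is a mapping $\theta:\mathbb{N}\to\mathbb{N}$ satisfying $\sum_{k=0}^{\theta(n)}a_k\geq n$ for all $n\in\mathbb{N}$. *)

theory Defs
  imports "HOL-Analysis.Analysis"
begin

definition strict_pseudo_contraction ::
  "real \<Rightarrow> 'a::real_inner set \<Rightarrow> ('a \<Rightarrow> 'a) \<Rightarrow> bool" where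
  "strict_pseudo_contraction \<kappa> C T \<longleftrightarrow>
     0 \<le> \<kappa> \<and> \<kappa> < 1 \<and> T \<in> C \<rightarrow> C \<and>
     (\<forall>u\<in>C. \<forall>v\<in>C.
        (norm (T u - T v))\<^sup>2 \<le> (norm (u - v))\<^sup>2 + \<kappa> * (norm (u - T u - (v - T v)))\<^sup>2)"

definition has_approx_fixed_points ::
  "'a::real_normed_vector set \<Rightarrow> ('a \<Rightarrow> 'a) \<Rightarrow> 'a \<Rightarrow> real \<Rightarrow> bool" where
  "has_approx_fixed_points C T x b \<longleftrightarrow>
     (\<forall>\<delta>>0. \<exists>y\<in>C. norm (x - y) \<le> b \<and> norm (y - T y) < \<delta>)"

definition rate_of_divergence :: "(nat \<Rightarrow> real) \<Rightarrow> (nat \<Rightarrow> nat) \<Rightarrow> bool" where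
  "rate_of_divergence a \<theta> \<longleftrightarrow> (\<forall>n. (\<Sum>k=0..\<theta> n. a k) \<ge> real n)"

primrec mann :: "('a::real_vector \<Rightarrow> 'a) \<Rightarrow> (nat \<Rightarrow> real) \<Rightarrow> 'a \<Rightarrow> nat \<Rightarrow> 'a" where
  "mann T l x 0 = x"
| "mann T l x (Suc n) = l n *\<^sub>R mann T l x n + (1 - l n) *\<^sub>R T (mann T l x n)"

definition Phi :: "real \<Rightarrow> real \<Rightarrow> (nat \<Rightarrow> nat) \<Rightarrow> nat" where
  "Phi \<epsilon> b \<theta> = \<theta> (nat \<lceil>b\<^sup>2 / \<epsilon>\<^sup>2\<rceil>)"

end

theory Submission
  imports Defs
begin

text \<open>
  A map \<open>T\<close> is a \<open>\<kappa>\<close>-strict pseudo-contraction iff \<open>A = I - T\<close> is \<open>\<beta>\<close>-cocoercive for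
  \<open>\<beta> = (1 - \<kappa>) / 2\<close>, and the Mann iteration is \<open>z (n + 1) = z n - \<mu> n *\<^sub>R A (z n)\<close> with step
  sizes \<open>\<mu> n = 1 - l n < 2 * \<beta>\<close>. Cocoercivity makes the residuals \<open>\<parallel>A (z n)\<parallel>\<close> decrease, and each step
  reduces the squared distance to a zero of \<open>A\<close> by at least \<open>w n * \<parallel>A (z n)\<parallel>\<^sup>2\<close>, where
  \<open>w n = \<mu> n * (2 * \<beta> - \<mu> n) = (l n - \<kappa>) * (1 - l n)\<close>. Hence \<open>(\<Sum>k\<le>n. w k) * \<parallel>A (z n)\<parallel>\<^sup>2 \<le> b\<^sup>2\<close>.

  The rate needs this inequality to be strict, because \<open>b\<^sup>2 / \<epsilon>\<^sup>2\<close> may be an integer. It is strict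
  if the residual has dropped below its initial value. Otherwise the vectors \<open>A (z k)\<close>, \<open>k \<le> n\<close>, all
  equal one vector \<open>v\<close>, so the iteration has moved the distance \<open>s * \<parallel>v\<parallel>\<close>, \<open>s = (\<Sum>k<n. \<mu> k)\<close>, along
  a line towards the zeros, which are still at distance at least \<open>\<beta> * \<parallel>v\<parallel>\<close>. This gives
  \<open>(\<beta> + s) * \<parallel>v\<parallel> \<le> b\<close>, and \<open>(\<Sum>k\<le>n. w k) \<le> \<beta>\<^sup>2 + 2 * \<beta> * s = (\<beta> + s)\<^sup>2 - s\<^sup>2\<close>.
\<close>

definition cocoercive_on :: "real \<Rightarrow> 'a::real_inner set \<Rightarrow> ('a \<Rightarrow> 'a) \<Rightarrow> bool" where
  "cocoercive_on \<beta> C A \<longleftrightarrow>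
     (\<forall>u\<in>C. \<forall>v\<in>C. \<beta> * (norm (A u - A v))\<^sup>2 \<le> (u - v) \<bullet> (A u - A v))"

lemma cocoercive_onD:
  assumes "cocoercive_on \<beta> C A" and "u \<in> C" and "v \<in> C"
  shows "\<beta> * (norm (A u - A v))\<^sup>2 \<le> (u - v) \<bullet> (A u - A v)"
  using assms unfolding cocoercive_on_def by blast

lemma norm_diff_square:
  fixes u v :: "'a::real_inner"
  shows "(norm (u - v))\<^sup>2 = (norm u)\<^sup>2 - 2 * (u \<bullet> v) + (norm v)\<^sup>2"
  by (simp add: dot_norm_neg field_simps)

lemma strict_pseudo_contraction_iff_cocoercive:
  "strict_pseudo_contraction \<kappa> C T \<longleftrightarrow>
     0 \<le> \<kappa> \<and> \<kappa> < 1 \<and> T \<in> C \<rightarrow> C \<and> cocoercive_on ((1 - \<kappa>) / 2) C (\<lambda>u. u - T u)"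
proof -
  have "(norm (T u - T v))\<^sup>2 \<le> (norm (u - v))\<^sup>2 + \<kappa> * (norm (u - T u - (v - T v)))\<^sup>2 \<longleftrightarrow>
      (1 - \<kappa>) / 2 * (norm (u - T u - (v - T v)))\<^sup>2 \<le> (u - v) \<bullet> (u - T u - (v - T v))" for u v
  proof -
    define d where "d = u - T u - (v - T v)"
    have "T u - T v = (u - v) - d"
      by (simp add: d_def)
    then have "(norm (T u - T v))\<^sup>2 = (norm (u - v))\<^sup>2 - 2 * ((u - v) \<bullet> d) + (norm d)\<^sup>2"
      by (simp only: norm_diff_square)
    then show ?thesis
      unfolding d_def[symmetric] by (auto simp: field_simps)
  qed
  then show ?thesis
    unfolding strict_pseudo_contraction_def cocoercive_on_def by blast
qed

lemma cocoercive_on_inner_ge: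
  assumes "cocoercive_on \<beta> C A" and "0 \<le> \<beta>" and "u \<in> C" and "p \<in> C"
  shows "\<beta> * (norm (A u))\<^sup>2 \<le> (u - p) \<bullet> A u + (2 * \<beta> * norm (A u) + norm (u - p)) * norm (A p)"
proof -
  have "\<beta> * (norm (A u))\<^sup>2 \<le> \<beta> * (norm (A u - A p))\<^sup>2 + 2 * \<beta> * (A u \<bullet> A p)"
    using \<open>0 \<le> \<beta>\<close> by (simp add: norm_diff_square algebra_simps)
  also have "\<dots> \<le> (u - p) \<bullet> (A u - A p) + 2 * \<beta> * (A u \<bullet> A p)"
    using cocoercive_onD[OF assms(1,3,4)] by simp
  also have "\<dots> = (u - p) \<bullet> A u + (2 * \<beta> * (A u \<bullet> A p) - (u - p) \<bullet> A p)"
    by (simp add: inner_diff_right)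
  also have "\<dots> \<le> (u - p) \<bullet> A u
      + (2 * \<beta> * (norm (A u) * norm (A p)) + norm (u - p) * norm (A p))"
  proof -
    have "2 * \<beta> * (A u \<bullet> A p) \<le> 2 * \<beta> * (norm (A u) * norm (A p))"
      using \<open>0 \<le> \<beta>\<close> by (intro mult_left_mono norm_cauchy_schwarz) simp
    moreover have "- ((u - p) \<bullet> A p) \<le> norm (u - p) * norm (A p)"
      using Cauchy_Schwarz_ineq2[of "u - p" "A p"] by linarith
    ultimately show ?thesis
      by linarith
  qed
  finally show ?thesis
    by (simp add: algebra_simps)
qed

locale cocoercive_iteration =
  fixes C :: "'a::real_inner set" and A :: "'a \<Rightarrow> 'a" and \<beta> :: real
    and \<mu> :: "nat \<Rightarrow> real" and z :: "nat \<Rightarrow> 'a"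
  assumes cocoercive: "cocoercive_on \<beta> C A"
    and iterate_in: "z n \<in> C"
    and iterate_Suc: "z (Suc n) = z n - \<mu> n *\<^sub>R A (z n)"
    and step_pos: "0 < \<mu> n"
    and step_less: "\<mu> n < 2 * \<beta>"
begin

abbreviation residual :: "nat \<Rightarrow> real" where "residual n \<equiv> norm (A (z n))"

abbreviation weight :: "nat \<Rightarrow> real" where "weight n \<equiv> \<mu> n * (2 * \<beta> - \<mu> n)"

abbreviation total_step :: "nat \<Rightarrow> real" where "total_step n \<equiv> \<Sum>k<n. \<mu> k"

lemma beta_pos: "0 < \<beta>"
  using step_pos[of 0] step_less[of 0] by simp

lemma weight_pos: "0 < weight n"
  using step_pos step_less by simp

lemma total_step_nonneg: "0 \<le> total_step n"
  by (intro sum_nonneg less_imp_le step_pos)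

lemma sum_weight_le: "(\<Sum>k\<le>n. weight k) \<le> \<beta>\<^sup>2 + 2 * \<beta> * total_step n"
proof -
  have "weight k \<le> 2 * \<beta> * \<mu> k" for k
    by (simp add: algebra_simps)
  then have "(\<Sum>k<n. weight k) \<le> 2 * \<beta> * total_step n"
    by (simp only: sum_distrib_left sum_mono)
  moreover have "weight n \<le> \<beta>\<^sup>2"
    using zero_le_power2[of "\<beta> - \<mu> n"] by (simp add: power2_eq_square algebra_simps)
  ultimately show ?thesis
    by (simp add: lessThan_Suc_atMost[symmetric])
qed

lemma residual_Suc_square_le:
  "\<mu> n * (residual (Suc n))\<^sup>2 + (2 * \<beta> - \<mu> n) * (norm (A (z n) - A (z (Suc n))))\<^sup>2
    \<le> \<mu> n * (residual n)\<^sup>2"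
proof -
  define d where "d = A (z n) - A (z (Suc n))"
  have cocoercive_step: "\<beta> * (norm d)\<^sup>2 \<le> \<mu> n * (A (z n) \<bullet> d)"
    using cocoercive_onD[OF cocoercive iterate_in iterate_in, of n "Suc n"]
    by (simp add: d_def iterate_Suc)
  have "(residual (Suc n))\<^sup>2 = (residual n)\<^sup>2 - 2 * (A (z n) \<bullet> d) + (norm d)\<^sup>2"
    using norm_diff_square[of "A (z n)" d] by (simp add: d_def)
  then have "\<mu> n * (residual (Suc n))\<^sup>2 + (2 * \<beta> - \<mu> n) * (norm d)\<^sup>2
      = \<mu> n * (residual n)\<^sup>2 - 2 * (\<mu> n * (A (z n) \<bullet> d) - \<beta> * (norm d)\<^sup>2)"
    by (simp only:) (simp add: algebra_simps)
  also have "\<dots> \<le> \<mu> n * (residual n)\<^sup>2"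
    using cocoercive_step by simp
  finally show ?thesis
    unfolding d_def .
qed

lemma decseq_residual: "decseq residual"
proof (rule decseq_SucI)
  fix n
  have "0 \<le> (2 * \<beta> - \<mu> n) * (norm (A (z n) - A (z (Suc n))))\<^sup>2"
    using step_less[of n] by simp
  then have "\<mu> n * (residual (Suc n))\<^sup>2 \<le> \<mu> n * (residual n)\<^sup>2"
    using residual_Suc_square_le[of n] by linarith
  then have "(residual (Suc n))\<^sup>2 \<le> (residual n)\<^sup>2"
    using step_pos[of n] by (rule mult_left_le_imp_le)
  then show "residual (Suc n) \<le> residual n"
    by (rule power2_le_imp_le) simp
qed

lemma image_Suc_eq:
  assumes "residual (Suc n) = residual n"
  shows "A (z (Suc n)) = A (z n)"
proof -
  have "(2 * \<beta> - \<mu> n) * (norm (A (z n) - A (z (Suc n))))\<^sup>2 \<le> 0"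
    using residual_Suc_square_le[of n] assms by simp
  then show ?thesis
    using step_less[of n] by (simp add: mult_le_0_iff)
qed

lemma image_eq_if_residual_eq:
  assumes "residual n = residual 0" and "k \<le> n"
  shows "A (z k) = A (z 0)"
  using \<open>k \<le> n\<close>
proof (induction k)
  case (Suc k)
  then have "A (z k) = A (z 0)"
    by simp
  moreover have "A (z (Suc k)) = A (z k)"
  proof (rule image_Suc_eq[OF antisym])
    show "residual (Suc k) \<le> residual k"
      by (rule decseq_SucD[OF decseq_residual])
    show "residual k \<le> residual (Suc k)"
      using decseqD[OF decseq_residual Suc.prems] \<open>A (z k) = A (z 0)\<close> assms(1) by simp
  qed
  ultimately show ?case
    by simp
qed simp

lemma iterate_eq_if_residual_eq:
  assumes "residual n = residual 0"
  shows "z n = z 0 - total_step n *\<^sub>R A (z 0)"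
proof -
  have "z k = z 0 - total_step k *\<^sub>R A (z 0)" if "k \<le> n" for k
    using that
  proof (induction k)
    case (Suc k)
    then show ?case
      using image_eq_if_residual_eq[OF assms, of k] by (simp add: iterate_Suc algebra_simps)
  qed simp
  then show ?thesis
    by blast
qed

lemma norm_iterate_diff_square:
  "(norm (z (Suc n) - p))\<^sup>2
    = (norm (z n - p))\<^sup>2 - 2 * \<mu> n * ((z n - p) \<bullet> A (z n)) + (\<mu> n)\<^sup>2 * (residual n)\<^sup>2"
proof -
  have "z (Suc n) - p = (z n - p) - \<mu> n *\<^sub>R A (z n)"
    by (simp add: iterate_Suc)
  then show ?thesis
    by (simp only: norm_diff_square) (simp add: power_mult_distrib)
qed

lemma descent:
  assumes "\<And>k. k < n \<Longrightarrow> \<beta> * (residual k)\<^sup>2 \<le> (z k - p) \<bullet> A (z k) + \<eta>"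
  shows "(norm (z n - p))\<^sup>2 + (\<Sum>k<n. weight k * (residual k)\<^sup>2)
    \<le> (norm (z 0 - p))\<^sup>2 + 2 * total_step n * \<eta>"
  using assms
proof (induction n)
  case (Suc n)
  have "2 * \<mu> n * (\<beta> * (residual n)\<^sup>2) \<le> 2 * \<mu> n * ((z n - p) \<bullet> A (z n) + \<eta>)"
    using Suc.prems step_pos[of n] by (intro mult_left_mono) auto
  then have "(norm (z (Suc n) - p))\<^sup>2 + weight n * (residual n)\<^sup>2
      \<le> (norm (z n - p))\<^sup>2 + 2 * \<mu> n * \<eta>"
    unfolding norm_iterate_diff_square by (simp add: algebra_simps power2_eq_square)
  moreover have "(norm (z n - p))\<^sup>2 + (\<Sum>k<n. weight k * (residual k)\<^sup>2)
      \<le> (norm (z 0 - p))\<^sup>2 + 2 * total_step n * \<eta>"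
    using Suc.prems by (intro Suc.IH) simp
  moreover have "2 * total_step (Suc n) * \<eta> = 2 * total_step n * \<eta> + 2 * \<mu> n * \<eta>"
    by (simp add: distrib_left distrib_right)
  ultimately show ?case
    unfolding sum.lessThan_Suc[of "\<lambda>k. weight k * (residual k)\<^sup>2"] by linarith
qed simp

end

locale cocoercive_iteration_near_zeros = cocoercive_iteration +
  fixes b :: real
  assumes approx_zeros: "0 < \<delta> \<Longrightarrow> \<exists>p\<in>C. norm (z 0 - p) \<le> b \<and> norm (A p) < \<delta>"
begin

lemma radius_nonneg: "0 \<le> b"
  using approx_zeros[OF zero_less_one] norm_ge_zero order_trans by blast

lemma near_zeroE:
  assumes "0 < \<eta>"
  obtains p where "norm (z 0 - p) \<le> b"
    and "\<And>k. k \<le> n \<Longrightarrow> \<beta> * (residual k)\<^sup>2 \<le> (z k - p) \<bullet> A (z k) + \<eta>"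
proof -
  define c where "c k = 2 * \<beta> * residual k + norm (z k - z 0)" for k
  define K where "K = (\<Sum>k\<le>n. c k) + b + 1"
  have c: "0 \<le> c k" for k
    using beta_pos by (simp add: c_def)
  then have "0 < K"
    using radius_nonneg by (simp add: K_def add_nonneg_pos sum_nonneg)
  obtain p where p: "p \<in> C" "norm (z 0 - p) \<le> b" "norm (A p) < \<eta> / K"
    using approx_zeros[of "\<eta> / K"] \<open>0 < \<eta>\<close> \<open>0 < K\<close> by auto
  show thesis
  proof
    fix k
    assume "k \<le> n"
    have "norm (z k - p) \<le> norm (z k - z 0) + b"
      using norm_triangle_ineq[of "z k - z 0" "z 0 - p"] p(2) by simp
    moreover have "c k \<le> (\<Sum>k\<le>n. c k)"
      using \<open>k \<le> n\<close> c by (intro member_le_sum) auto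
    ultimately have "2 * \<beta> * residual k + norm (z k - p) \<le> K"
      by (simp add: c_def K_def)
    then have "(2 * \<beta> * residual k + norm (z k - p)) * norm (A p) \<le> K * (\<eta> / K)"
      using p(3) \<open>0 < K\<close> by (intro mult_mono) auto
    then have "(2 * \<beta> * residual k + norm (z k - p)) * norm (A p) \<le> \<eta>"
      using \<open>0 < K\<close> by simp
    then show "\<beta> * (residual k)\<^sup>2 \<le> (z k - p) \<bullet> A (z k) + \<eta>"
      using cocoercive_on_inner_ge[OF cocoercive less_imp_le[OF beta_pos] iterate_in p(1), of k]
      by linarith
  qed (fact p(2))
qed

lemma sum_weighted_residuals_le: "(\<Sum>k<n. weight k * (residual k)\<^sup>2) \<le> b\<^sup>2"
proof (rule field_le_epsilon)
  fix e :: real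
  assume "0 < e"
  define \<eta> where "\<eta> = e / (2 * total_step n + 1)"
  have "0 < \<eta>"
    using \<open>0 < e\<close> total_step_nonneg[of n] by (simp add: \<eta>_def)
  then obtain p where p: "norm (z 0 - p) \<le> b"
    "\<And>k. k \<le> n \<Longrightarrow> \<beta> * (residual k)\<^sup>2 \<le> (z k - p) \<bullet> A (z k) + \<eta>"
    using near_zeroE by blast
  have "(norm (z n - p))\<^sup>2 + (\<Sum>k<n. weight k * (residual k)\<^sup>2)
      \<le> (norm (z 0 - p))\<^sup>2 + 2 * total_step n * \<eta>"
    using p(2) by (intro descent) simp
  moreover have "(norm (z 0 - p))\<^sup>2 \<le> b\<^sup>2"
    using p(1) by (simp add: power_mono)
  moreover have "2 * total_step n * \<eta> \<le> e"
    using \<open>0 < e\<close> total_step_nonneg[of n] by (simp add: \<eta>_def field_simps)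
  ultimately show "(\<Sum>k<n. weight k * (residual k)\<^sup>2) \<le> b\<^sup>2 + e"
    using zero_le_power2[of "norm (z n - p)"] by linarith
qed

lemma total_step_residual_le:
  assumes "residual n = residual 0"
  shows "(\<beta> + total_step n) * residual 0 \<le> b"
proof -
  have "(\<beta> + total_step n) * (residual 0)\<^sup>2 \<le> b * residual 0"
  proof (rule field_le_epsilon)
    fix \<eta> :: real
    assume "0 < \<eta>"
    then obtain p where p: "norm (z 0 - p) \<le> b"
      "\<And>k. k \<le> n \<Longrightarrow> \<beta> * (residual k)\<^sup>2 \<le> (z k - p) \<bullet> A (z k) + \<eta>"
      using near_zeroE by blast
    have "\<beta> * (residual 0)\<^sup>2 \<le> (z n - p) \<bullet> A (z 0) + \<eta>"
      using p(2)[of n] image_eq_if_residual_eq[OF assms, of n] by simp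
    also have "(z n - p) \<bullet> A (z 0) = (z 0 - p) \<bullet> A (z 0) - total_step n * (residual 0)\<^sup>2"
      unfolding iterate_eq_if_residual_eq[OF assms]
      by (simp add: inner_diff_left power2_norm_eq_inner)
    also have "(z 0 - p) \<bullet> A (z 0) \<le> b * residual 0"
      using p(1) norm_cauchy_schwarz[of "z 0 - p" "A (z 0)"]
        mult_right_mono[of "norm (z 0 - p)" b "residual 0"] by simp
    finally show "(\<beta> + total_step n) * (residual 0)\<^sup>2 \<le> b * residual 0 + \<eta>"
      by (simp add: algebra_simps)
  qed
  then have "(\<beta> + total_step n) * residual 0 * residual 0 \<le> b * residual 0"
    by (simp add: power2_eq_square mult.assoc)
  then show ?thesis
    using radius_nonneg by (cases "A (z 0) = 0") auto
qed

lemma sum_weight_residual_less_if_dropped: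
  assumes "residual n < residual 0"
  shows "(\<Sum>k\<le>n. weight k) * (residual n)\<^sup>2 < b\<^sup>2"
proof -
  have "(\<Sum>k\<le>n. weight k) * (residual n)\<^sup>2 = (\<Sum>k\<le>n. weight k * (residual n)\<^sup>2)"
    by (rule sum_distrib_right)
  also have "\<dots> < (\<Sum>k\<le>n. weight k * (residual k)\<^sup>2)"
  proof (rule sum_strict_mono_ex1)
    show "\<forall>k\<in>{..n}. weight k * (residual n)\<^sup>2 \<le> weight k * (residual k)\<^sup>2"
      using decseq_residual
      by (intro ballI mult_left_mono power_mono less_imp_le[OF weight_pos]) (auto simp: decseq_def)
    show "\<exists>k\<in>{..n}. weight k * (residual n)\<^sup>2 < weight k * (residual k)\<^sup>2"
      using assms
      by (intro bexI[of _ 0] mult_strict_left_mono power_strict_mono weight_pos) auto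
  qed simp
  also have "\<dots> \<le> b\<^sup>2"
    using sum_weighted_residuals_le[of "Suc n"] by (simp only: lessThan_Suc_atMost)
  finally show ?thesis .
qed

lemma sum_weight_residual_less_if_constant:
  assumes eq: "residual n = residual 0" and small: "\<beta> * residual 0 < b"
  shows "(\<Sum>k\<le>n. weight k) * (residual n)\<^sup>2 < b\<^sup>2"
proof -
  define s r where "s = total_step n" and "r = residual 0"
  have nonneg: "0 \<le> s" "0 \<le> r"
    using total_step_nonneg by (simp_all add: s_def r_def)
  have "(\<Sum>k\<le>n. weight k) * r\<^sup>2 \<le> (\<beta>\<^sup>2 + 2 * \<beta> * s) * r\<^sup>2"
    using sum_weight_le[of n] by (intro mult_right_mono) (simp_all add: s_def)
  also have "\<dots> = ((\<beta> + s) * r)\<^sup>2 - (s * r)\<^sup>2"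
    by (simp add: power2_eq_square algebra_simps)
  also have "\<dots> < b\<^sup>2"
  proof (cases "s * r = 0")
    case True
    then have "((\<beta> + s) * r)\<^sup>2 - (s * r)\<^sup>2 = (\<beta> * r)\<^sup>2"
      by (simp only: distrib_right True) simp
    also have "\<dots> < b\<^sup>2"
      using small nonneg beta_pos unfolding r_def by (intro power_strict_mono) auto
    finally show ?thesis .
  next
    case False
    then have "((\<beta> + s) * r)\<^sup>2 - (s * r)\<^sup>2 < ((\<beta> + s) * r)\<^sup>2"
      by simp
    also have "\<dots> \<le> b\<^sup>2"
      using total_step_residual_le[OF eq] nonneg beta_pos
      unfolding s_def r_def by (intro power_mono) auto
    finally show ?thesis .
  qed
  finally show ?thesis
    unfolding r_def eq .
qed

lemma sum_weight_residual_less: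
  assumes "\<beta> * residual 0 < b"
  shows "(\<Sum>k\<le>n. weight k) * (residual n)\<^sup>2 < b\<^sup>2"
proof (cases "residual n = residual 0")
  case True
  then show ?thesis
    using assms by (rule sum_weight_residual_less_if_constant)
next
  case False
  then show ?thesis
    using decseqD[OF decseq_residual, of 0 n] by (intro sum_weight_residual_less_if_dropped) simp
qed

end

lemma mann_in:
  assumes "convex C" and "T \<in> C \<rightarrow> C" and "\<And>n. l n \<in> {0..1}" and "x \<in> C"
  shows "mann T l x n \<in> C"
proof (induction n)
  case (Suc n)
  moreover have "T (mann T l x n) \<in> C"
    using assms(2) Suc by blast
  ultimately show ?case
    using assms(1,3) by (simp add: convexD)
qed (simp add: \<open>x \<in> C\<close>)

lemma less_if_rate_of_divergence:
  fixes r :: "nat \<Rightarrow> real"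
  assumes rate: "rate_of_divergence a \<theta>" and "decseq r"
    and bound: "\<And>n. (\<Sum>k\<le>n. a k) * (r n)\<^sup>2 < b\<^sup>2"
    and "0 < \<epsilon>" and "Phi \<epsilon> b \<theta> \<le> n"
  shows "r n < \<epsilon>"
proof (rule ccontr)
  define N where "N = Phi \<epsilon> b \<theta>"
  assume "\<not> r n < \<epsilon>"
  then have "\<epsilon> \<le> r N"
    using decseqD[OF \<open>decseq r\<close> \<open>Phi \<epsilon> b \<theta> \<le> n\<close>] by (simp add: N_def)
  have "b\<^sup>2 / \<epsilon>\<^sup>2 \<le> nat \<lceil>b\<^sup>2 / \<epsilon>\<^sup>2\<rceil>"
    by (rule real_nat_ceiling_ge)
  also have "\<dots> \<le> (\<Sum>k\<le>N. a k)"
    using rate unfolding rate_of_divergence_def N_def Phi_def atLeast0AtMost by blast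
  finally have sum_ge: "b\<^sup>2 / \<epsilon>\<^sup>2 \<le> (\<Sum>k\<le>N. a k)" .
  have "b\<^sup>2 = b\<^sup>2 / \<epsilon>\<^sup>2 * \<epsilon>\<^sup>2"
    using \<open>0 < \<epsilon>\<close> by simp
  also have "\<dots> \<le> (\<Sum>k\<le>N. a k) * (r N)\<^sup>2"
  proof (rule mult_mono[OF sum_ge])
    show "\<epsilon>\<^sup>2 \<le> (r N)\<^sup>2"
      using \<open>\<epsilon> \<le> r N\<close> \<open>0 < \<epsilon>\<close> by (simp add: power_mono)
    show "0 \<le> (\<Sum>k\<le>N. a k)"
      using sum_ge by (rule order_trans[rotated]) simp
  qed simp
  also have "\<dots> < b\<^sup>2"
    by (rule bound)
  finally show False
    by simp
qed

lemma mann_cocoercive_iteration: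
  assumes "convex C" and T: "strict_pseudo_contraction \<kappa> C T" and l: "\<And>n. l n \<in> {\<kappa><..<1}"
    and "x \<in> C" and approx: "has_approx_fixed_points C T x b"
  shows "cocoercive_iteration_near_zeros
    C (\<lambda>u. u - T u) ((1 - \<kappa>) / 2) (\<lambda>n. 1 - l n) (mann T l x) b"
proof
  have "0 \<le> \<kappa>" and T_in: "T \<in> C \<rightarrow> C"
    using T unfolding strict_pseudo_contraction_iff_cocoercive by blast+
  have l_bounds: "\<kappa> < l n" "l n < 1" for n
    using l[of n] by auto
  show "cocoercive_on ((1 - \<kappa>) / 2) C (\<lambda>u. u - T u)"
    using T unfolding strict_pseudo_contraction_iff_cocoercive by blast
  have "l n \<in> {0..1}" for n
    using l_bounds[of n] \<open>0 \<le> \<kappa>\<close> by simp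
  with \<open>convex C\<close> T_in show "mann T l x n \<in> C" for n
    using \<open>x \<in> C\<close> by (rule mann_in)
  show "mann T l x (Suc n) = mann T l x n - (1 - l n) *\<^sub>R (mann T l x n - T (mann T l x n))" for n
    by (simp add: algebra_simps)
  show "0 < 1 - l n" "1 - l n < 2 * ((1 - \<kappa>) / 2)" for n
    using l_bounds[of n] by simp_all
  show "\<exists>p\<in>C. norm (mann T l x 0 - p) \<le> b \<and> norm (p - T p) < \<delta>" if "0 < \<delta>" for \<delta>
    using approx that unfolding has_approx_fixed_points_def by simp
qed

theorem theorem2p1:
  fixes C :: "'a::{real_inner,complete_space} set"
    and T :: "'a \<Rightarrow> 'a"
    and \<kappa> b :: real
    and l :: "nat \<Rightarrow> real"
    and \<theta> :: "nat \<Rightarrow> nat"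
    and x :: 'a
  assumes "C \<noteq> {}" and "convex C"
    and "0 \<le> \<kappa>" and "\<kappa> < 1"
    and "strict_pseudo_contraction \<kappa> C T"
    and "\<And>n. l n \<in> {\<kappa><..<1}"
    and "filterlim (\<lambda>n. \<Sum>k<n. (l k - \<kappa>) * (1 - l k)) at_top sequentially"
    and "rate_of_divergence (\<lambda>n. (l n - \<kappa>) * (1 - l n)) \<theta>"
    and "x \<in> C" and "b > 0"
    and "norm (x - T x) \<le> b"
    and "has_approx_fixed_points C T x b"
  shows "(\<lambda>n. norm (mann T l x n - T (mann T l x n))) \<longlonglongrightarrow> 0 \<and>
         (\<forall>\<epsilon>>0. \<forall>n\<ge>Phi \<epsilon> b \<theta>. norm (mann T l x n - T (mann T l x n)) < \<epsilon>)"
proof -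
  interpret cocoercive_iteration_near_zeros
    C "\<lambda>u. u - T u" "(1 - \<kappa>) / 2" "\<lambda>n. 1 - l n" "mann T l x" b
    using assms(2,5,6,9,12) by (rule mann_cocoercive_iteration)
  have "(1 - \<kappa>) / 2 * norm (x - T x) \<le> 1 / 2 * b"
    using assms(3,4,11) by (intro mult_mono) auto
  then have start: "(1 - \<kappa>) / 2 * residual 0 < b"
    using \<open>b > 0\<close> by simp
  have "weight k = (l k - \<kappa>) * (1 - l k)" for k
    by (simp add: field_simps)
  then have bound: "(\<Sum>k\<le>n. (l k - \<kappa>) * (1 - l k)) * (residual n)\<^sup>2 < b\<^sup>2" for n
    using sum_weight_residual_less[OF start, of n] by (simp only:)
  have rate: "residual n < \<epsilon>" if "0 < \<epsilon>" and "Phi \<epsilon> b \<theta> \<le> n" for \<epsilon> n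
    using assms(8) decseq_residual bound that by (rule less_if_rate_of_divergence)
  have "residual \<longlonglongrightarrow> 0"
    by (rule LIMSEQ_I) (use rate in auto)
  with rate show ?thesis
    by blast
qed

end
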